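(* Let $Y=\phi X+N$ be the scalar Gaussian channel, where $X$ is a real random variable (the input), $\phi\in\mathbb{R}$ is the scaling factor, and $N\sim\mathcal{N}(0,1)$ is independent of $X$. Then the derivative of mutual information with respect to the scaling factor is given by $$\frac{\partial}{\partial\phi}I(X;Y)=\mathbb{E}\big[D_F(X,\mathbb{E}[X|Y])\big],$$ where $F(x)=\phi x^2$.
   Context: $I(X;Y)$ is the mutual information (natural logarithms), regarded as a function of $\phi$ for a fixed distribution of $X$. $D_F$ is the Bregman divergence associated with $F$, given by $D_F(x,y)=F(x)-F(y)-F'(y)(x-y)$ for $x,y\in\mathbb{R}$. Standing assumption: the regularity conditions needed to interchange freely the order of differentiation and expectation hold (in particular the quantities involved are well defined). *)

theory Defs
  imports "HOL-Probability.Probability"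
begin

definition bregman_divergence :: "(real \<Rightarrow> real) \<Rightarrow> real \<Rightarrow> real \<Rightarrow> real" where
  "bregman_divergence F x y = F x - F y - deriv F y * (x - y)"

definition gaussian_output :: "real \<Rightarrow> ('a \<Rightarrow> real) \<Rightarrow> ('a \<Rightarrow> real) \<Rightarrow> 'a \<Rightarrow> real" where
  "gaussian_output \<phi> X N = (\<lambda>\<omega>. \<phi> * X \<omega> + N \<omega>)"

definition cond_exp_given :: "'a measure \<Rightarrow> ('a \<Rightarrow> real) \<Rightarrow> ('a \<Rightarrow> real) \<Rightarrow> 'a \<Rightarrow> real" where
  "cond_exp_given M X Y = real_cond_exp M (vimage_algebra (space M) Y borel) X"

definition mutual_information_nats :: "'a measure \<Rightarrow> ('a \<Rightarrow> real) \<Rightarrow> ('a \<Rightarrow> real) \<Rightarrow> real" where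
  "mutual_information_nats M X Y = prob_space.mutual_information M (exp 1) borel borel X Y"

end

theory Submission
  imports Defs
begin

text \<open>Write \<open>P\<close> for the law of the input, \<open>f\<^sub>t\<close> for the density of the output \<open>Y\<^sub>t\<close> and \<open>n\<close> for the
  noise density, so that \<open>I(t) = E[ln n(N) - ln f\<^sub>t(Y\<^sub>t)]\<close>. For \<open>r \<noteq> 0\<close> and fixed values of \<open>X\<close> and \<open>N\<close>,
  the path \<open>t \<mapsto> ln f\<^sub>t(t X + N)\<close> has at \<open>r\<close> the derivative \<open>(N E[N|Y\<^sub>r] - E[N\<^sup>2|Y\<^sub>r]) / r\<close>: replacing
  \<open>X - X'\<close>, for a replica \<open>X'\<close> of the input, by a difference of noises over \<open>r\<close> leaves only Gaussian
  moments, so no second moment of \<open>X\<close> is involved. Its expectation is \<open>(J(r) - 1) / r\<close> with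
  \<open>J(r) = E[E[N|Y\<^sub>r]\<^sup>2]\<close>, its \<open>L\<^sup>1\<close> norm is at most \<open>2/\<bar>r\<bar>\<close>, and \<open>J\<close> is continuous, so Fubini and
  the fundamental theorem of calculus give \<open>I'(r) = (1 - J(r)) / r\<close>. Since
  \<open>X - E[X|Y\<^sub>r] = (E[N|Y\<^sub>r] - N) / r\<close>, this is \<open>r\<close> times the mean square error. At \<open>0\<close> the hypothesis
  makes \<open>X\<close> square integrable, and Jensen's inequality gives \<open>0 \<le> I(t) \<le> t\<^sup>2 Var(X)\<close>.\<close>

section \<open>Gaussian bounds, differentiation under the integral sign, quadratic
  divergences\<close>

text \<open>Since \<open>exp v \<ge> 1 + v\<close> at \<open>v = u\<^sup>2 / 2\<close> and
  \<open>sqrt (2 * pi) \<ge> 2\<close>, the density is at most half of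
  \<open>1 / (1 + u\<^sup>2 / 2)\<close>, which absorbs powers up to the second. The constant bound
  makes Gaussian integrals over the input law converge whatever that law is.\<close>

lemma std_normal_moment_le_1:
  assumes "k \<le> 2"
  shows "\<bar>u ^ k * std_normal_density u\<bar> \<le> 1"
proof -
  have "1 + u\<^sup>2 / 2 \<le> exp (u\<^sup>2 / 2)"
    by (rule exp_ge_add_one_self)
  moreover have "exp (- u\<^sup>2 / 2) * exp (u\<^sup>2 / 2) = 1"
    by (simp flip: exp_add)
  ultimately have "exp (- u\<^sup>2 / 2) * (1 + u\<^sup>2 / 2) \<le> 1"
    by (metis exp_ge_zero mult_left_mono)
  moreover have "sqrt (2 * pi) \<ge> 2"
    by (rule real_le_rsqrt) (use pi_gt3 in simp)
  ultimately have le: "std_normal_density u * (1 + u\<^sup>2 / 2) \<le> 1 / 2"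
    unfolding std_normal_density_def
    using mult_mono[of "1 / sqrt (2 * pi)" "1/2" "exp (- u\<^sup>2 / 2) * (1 + u\<^sup>2 / 2)" 1]
    by (simp add: field_simps)
  have "k = 0 \<or> k = 1 \<or> k = 2"
    using assms by auto
  moreover have "2 * \<bar>u\<bar> \<le> 1 + u\<^sup>2"
    using sum_squares_ge_zero[of "\<bar>u\<bar> - 1" 0] by (simp add: power2_eq_square algebra_simps)
  ultimately have "\<bar>u ^ k\<bar> \<le> 2 * (1 + u\<^sup>2 / 2)"
    by (auto simp: power_abs)
  then have "\<bar>u ^ k * std_normal_density u\<bar> \<le> 2 * (1 + u\<^sup>2 / 2) * std_normal_density u"
    by (simp add: abs_mult mult_right_mono)
  then show ?thesis
    using le by (simp add: algebra_simps)
qed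

text \<open>The mean value theorem bounds every difference quotient by \<open>w\<close>, so
  dominated convergence applies along each sequence of increments tending to 0.\<close>

lemma has_real_derivative_lebesgue_integral:
  fixes F F' :: "real \<Rightarrow> 'b \<Rightarrow> real"
  assumes int: "\<And>t. integrable M (F t)"
    and deriv: "\<And>t x. x \<in> space M \<Longrightarrow> ((\<lambda>t. F t x) has_real_derivative F' t x) (at t)"
    and bound: "\<And>t x. x \<in> space M \<Longrightarrow> \<bar>F' t x\<bar> \<le> w x"
    and w: "integrable M w"
    and meas: "F' t \<in> borel_measurable M"
  shows "((\<lambda>t. \<integral>x. F t x \<partial>M) has_real_derivative (\<integral>x. F' t x \<partial>M)) (at t)"
  unfolding DERIV_def
proof (rule tendsto_at_iff_sequentially[THEN iffD2], intro allI impI, unfold comp_def)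
  fix s :: "nat \<Rightarrow> real"
  assume s: "\<forall>i. s i \<in> UNIV - {0}" and lim: "s \<longlonglongrightarrow> 0"
  have "(\<lambda>i. \<integral>x. (F (t + s i) x - F t x) / s i \<partial>M) \<longlonglongrightarrow> (\<integral>x. F' t x \<partial>M)"
  proof (rule integral_dominated_convergence[where w=w])
    show "AE x in M. (\<lambda>i. (F (t + s i) x - F t x) / s i) \<longlonglongrightarrow> F' t x"
    proof (rule AE_I2)
      fix x assume "x \<in> space M"
      then have "((\<lambda>h. (F (t + h) x - F t x) / h) \<longlongrightarrow> F' t x) (at 0)"
        using deriv by (simp add: DERIV_def)
      then show "(\<lambda>i. (F (t + s i) x - F t x) / s i) \<longlonglongrightarrow> F' t x"
        using s lim unfolding tendsto_at_iff_sequentially comp_def by blast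
    qed
    show "AE x in M. norm ((F (t + s i) x - F t x) / s i) \<le> w x" for i
    proof (rule AE_I2)
      fix x assume x: "x \<in> space M"
      have "norm (F (t + s i) x - F t x) \<le> w x * norm (t + s i - t)"
        by (rule field_differentiable_bound[of UNIV _ "\<lambda>t. F' t x"]) (use x deriv bound in auto)
      then show "norm ((F (t + s i) x - F t x) / s i) \<le> w x"
        using s by (simp add: divide_simps abs_mult mult.commute)
    qed
  qed (use int meas w in \<open>auto intro!: borel_measurable_divide borel_measurable_diff\<close>)
  then show "(\<lambda>i. ((\<integral>x. F (t + s i) x \<partial>M) - (\<integral>x. F t x \<partial>M)) / s i) \<longlonglongrightarrow> (\<integral>x. F' t x \<partial>M)"
    using int by simp
qed

lemma has_real_derivative_std_normal_density:
  "(std_normal_density has_real_derivative - (u * std_normal_density u)) (at u)"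
proof -
  have "((\<lambda>u. c * exp (- u\<^sup>2 / 2)) has_real_derivative - (u * (c * exp (- u\<^sup>2 / 2)))) (at u)" for c :: real
    by (auto intro!: derivative_eq_intros)
  then show ?thesis
    unfolding std_normal_density_def .
qed

lemma ln_std_normal_density: "ln (std_normal_density u) = - ln (sqrt (2 * pi)) - u\<^sup>2 / 2"
  unfolding std_normal_density_def by (subst ln_mult_pos) (auto simp: ln_div)

text \<open>Turns the right-hand side of the theorem into \<open>\<phi>\<close> times the mean
  square error.\<close>

lemma bregman_divergence_square: "bregman_divergence (\<lambda>x. c * x\<^sup>2) x y = c * (x - y)\<^sup>2"
proof -
  have "((\<lambda>x. c * x\<^sup>2) has_real_derivative c * (2 * y)) (at y)"
    by (auto intro!: derivative_eq_intros)
  then have "deriv (\<lambda>x. c * x\<^sup>2) y = c * (2 * y)"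
    by (rule DERIV_imp_deriv)
  then show ?thesis
    by (simp add: bregman_divergence_def power2_eq_square algebra_simps)
qed

section \<open>The channel seen through the input law: noise moments and the output density\<close>

abbreviation std_normal :: "real measure" where
  "std_normal \<equiv> density lborel (\<lambda>x. ennreal (std_normal_density x))"

text \<open>Mutual information depends on the input only through its law \<open>P\<close>, so the
  analysis runs on the product space \<open>R\<close>, where \<open>fst w\<close> is the input and
  \<open>snd w\<close> the noise.\<close>

locale gaussian_channel = prob_space P for P :: "real measure" +
  assumes sets_P [measurable_cong, simp]: "sets P = sets borel"
    and integrable_input: "integrable P (\<lambda>x. x)"
begin

sublocale noise: prob_space std_normal
  by (rule prob_space_normal_density) simp

sublocale PN: pair_prob_space P std_normal ..

sublocale PL: pair_sigma_finite P lborel ..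

abbreviation R :: "(real \<times> real) measure" where
  "R \<equiv> P \<Otimes>\<^sub>M std_normal"

lemma space_P [simp]: "space P = UNIV"
  using sets_eq_imp_space_eq[OF sets_P] by simp

text \<open>\<open>mom 0 r\<close> is the density of the output at scale \<open>r\<close>; \<open>mom k r y / mom 0 r y\<close> is the conditional
  \<open>k\<close>-th moment of the noise given that the output is \<open>y\<close>.\<close>

definition mom :: "nat \<Rightarrow> real \<Rightarrow> real \<Rightarrow> real" where
  "mom k r y = (\<integral>x. (y - r * x) ^ k * std_normal_density (y - r * x) \<partial>P)"

lemma borel_measurable_mom [measurable (raw)]:
  assumes [measurable]: "f \<in> borel_measurable M" "g \<in> borel_measurable M"
  shows "(\<lambda>w. mom k (f w) (g w)) \<in> borel_measurable M"
  unfolding mom_def by measurable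

lemma integrable_mom:
  assumes "k \<le> 2"
  shows "integrable P (\<lambda>x. (y - r * x) ^ k * std_normal_density (y - r * x))"
  by (rule integrable_const_bound[where B=1]) (use std_normal_moment_le_1[OF assms] in auto)

lemma mom_nonneg: "even k \<Longrightarrow> 0 \<le> mom k r y"
  unfolding mom_def by (intro integral_nonneg_AE AE_I2) (simp add: zero_le_even_power)

text \<open>A strictly positive integrand cannot have integral 0 over a probability space.
  Conditional moments can thus be formed at every \<open>y\<close>, with no exceptional null
  set.\<close>

lemma mom_0_pos [simp]: "0 < mom 0 r y"
proof -
  have "mom 0 r y \<noteq> 0"
  proof
    assume "mom 0 r y = 0"
    then have "AE x in P. std_normal_density (y - r * x) = 0"
      unfolding mom_def using integrable_mom[of 0 y r]
      by (subst (asm) integral_nonneg_eq_0_iff_AE) auto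
    then have "AE x in P. False"
      by eventually_elim (use normal_density_pos[of 1 0] in \<open>auto simp: less_le\<close>)
    then show False
      by simp
  qed
  then show ?thesis
    using mom_nonneg[of 0 r y] by simp
qed

lemma mom_0_neq_0 [simp]: "mom 0 r y \<noteq> 0"
  using mom_0_pos[of r y] by linarith

lemma tendsto_mom:
  assumes "k \<le> 2" "s \<longlonglongrightarrow> r"
  shows "(\<lambda>i. mom k (s i) y) \<longlonglongrightarrow> mom k r y"
  unfolding mom_def
proof (rule integral_dominated_convergence[where w="\<lambda>_. 1"])
  show "AE x in P. norm ((y - s i * x) ^ k * std_normal_density (y - s i * x)) \<le> 1" for i
    using std_normal_moment_le_1[OF assms(1)] by auto
  show "AE x in P. (\<lambda>i. (y - s i * x) ^ k * std_normal_density (y - s i * x))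
      \<longlonglongrightarrow> (y - r * x) ^ k * std_normal_density (y - r * x)"
    unfolding std_normal_density_def by (intro AE_I2 tendsto_intros assms(2)) auto
qed auto

text \<open>Cauchy-Schwarz with weight \<open>std_normal_density (y - r * x)\<close>: the weighted
  second moment of the noise about its conditional mean \<open>e\<close> is nonnegative.\<close>

lemma mom_1_square_le: "(mom 1 r y)\<^sup>2 \<le> mom 0 r y * mom 2 r y"
proof -
  define e where "e = mom 1 r y / mom 0 r y"
  let ?u = "\<lambda>x. y - r * x" and ?n = "\<lambda>x. std_normal_density (y - r * x)"
  note [simp] = integrable_mom[of 0, simplified] integrable_mom[of 1, simplified] integrable_mom[of 2, simplified]
  have "0 \<le> (\<integral>x. (?u x - e)\<^sup>2 * ?n x \<partial>P)"
    by (intro integral_nonneg_AE AE_I2) simp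
  also have "(\<lambda>x. (?u x - e)\<^sup>2 * ?n x)
      = (\<lambda>x. (?u x)\<^sup>2 * ?n x - 2 * e * (?u x * ?n x) + e\<^sup>2 * ?n x)"
    by (simp add: power2_eq_square algebra_simps fun_eq_iff)
  also have "(\<integral>x. \<dots> x \<partial>P) = mom 2 r y - 2 * e * mom 1 r y + e\<^sup>2 * mom 0 r y"
    unfolding mom_def by simp
  also have "\<dots> = mom 2 r y - (mom 1 r y)\<^sup>2 / mom 0 r y"
    by (simp add: e_def power2_eq_square field_simps)
  finally show ?thesis
    by (simp add: field_simps)
qed

section \<open>Change of variables from input and noise to input and output\<close>

text \<open>For a fixed input the output is a translate of the noise, and Lebesgue measure is
  translation invariant.\<close>

lemma distr_channel:
  "distr R (P \<Otimes>\<^sub>M lborel) (\<lambda>w. (fst w, r * fst w + snd w))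
     = density (P \<Otimes>\<^sub>M lborel) (\<lambda>w. ennreal (std_normal_density (snd w - r * fst w)))"
proof (rule measure_eqI)
  fix A assume "A \<in> sets (distr R (P \<Otimes>\<^sub>M lborel) (\<lambda>w. (fst w, r * fst w + snd w)))"
  then have [measurable]: "A \<in> sets (P \<Otimes>\<^sub>M lborel)"
    by simp
  have [measurable]: "A \<in> sets (borel \<Otimes>\<^sub>M borel)"
    using \<open>A \<in> sets (P \<Otimes>\<^sub>M lborel)\<close> by (simp cong: sets_pair_measure_cong)
  have "emeasure (distr R (P \<Otimes>\<^sub>M lborel) (\<lambda>w. (fst w, r * fst w + snd w))) A
      = (\<integral>\<^sup>+ w. indicator A w \<partial>distr R (P \<Otimes>\<^sub>M lborel) (\<lambda>w. (fst w, r * fst w + snd w)))"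
    by simp
  also have "\<dots> = (\<integral>\<^sup>+ x. \<integral>\<^sup>+ z. ennreal (std_normal_density z) * indicator A (x, r * x + z) \<partial>lborel \<partial>P)"
    by (subst nn_integral_distr, measurable)
       (simp add: noise.nn_integral_fst[symmetric] case_prod_unfold nn_integral_density)
  also have "\<dots> = (\<integral>\<^sup>+ x. \<integral>\<^sup>+ y. ennreal (std_normal_density (y - r * x)) * indicator A (x, y) \<partial>lborel \<partial>P)"
  proof (rule nn_integral_cong)
    fix x
    show "(\<integral>\<^sup>+ z. ennreal (std_normal_density z) * indicator A (x, r * x + z) \<partial>lborel)
      = (\<integral>\<^sup>+ y. ennreal (std_normal_density (y - r * x)) * indicator A (x, y) \<partial>lborel)"
      by (subst (2) nn_integral_real_affine[where c=1 and t="r * x"]) auto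
  qed
  also have "\<dots> = emeasure (density (P \<Otimes>\<^sub>M lborel) (\<lambda>w. ennreal (std_normal_density (snd w - r * fst w)))) A"
    by (simp add: emeasure_density lborel.nn_integral_fst[symmetric] case_prod_unfold)
  finally show "emeasure (distr R (P \<Otimes>\<^sub>M lborel) (\<lambda>w. (fst w, r * fst w + snd w))) A = \<dots>" .
qed simp

lemma integrable_R_snd:
  fixes h :: "real \<Rightarrow> real"
  assumes "integrable std_normal h"
  shows "integrable R (\<lambda>w. h (snd w))" "(\<integral>w. h (snd w) \<partial>R) = (\<integral>z. h z \<partial>std_normal)"
proof -
  have [measurable]: "h \<in> borel_measurable borel"
    using borel_measurable_integrable[OF assms] by simp
  show int: "integrable R (\<lambda>w. h (snd w))"
    by (rule PN.Fubini_integrable) (use assms in \<open>auto simp: prob_space\<close>)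
  show "(\<integral>w. h (snd w) \<partial>R) = (\<integral>z. h z \<partial>std_normal)"
    using PN.integral_fst'[OF int] prob_space by simp
qed

lemma integrable_R_fst:
  fixes h :: "real \<Rightarrow> real"
  assumes "integrable P h"
  shows "integrable R (\<lambda>w. h (fst w))" "(\<integral>w. h (fst w) \<partial>R) = (\<integral>x. h x \<partial>P)"
proof -
  have [measurable]: "h \<in> borel_measurable borel"
    using borel_measurable_integrable[OF assms] by simp
  show int: "integrable R (\<lambda>w. h (fst w))"
    by (rule PN.Fubini_integrable) (use assms in \<open>auto simp: noise.prob_space\<close>)
  show "(\<integral>w. h (fst w) \<partial>R) = (\<integral>x. h x \<partial>P)"
    using PN.integral_fst'[OF int] noise.prob_space by simp
qed

lemma integrable_noise_power: "integrable std_normal (\<lambda>z. z ^ k)"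
  using integrable_std_normal_moment[of k] by (simp add: integrable_real_density)

lemma integral_noise: "(\<integral>z. z \<partial>std_normal) = 0" "(\<integral>z. z\<^sup>2 \<partial>std_normal) = 1"
  using integral_std_normal_moment_odd[of 0] integral_std_normal_moment_even[of 1]
  by (simp_all add: integral_real_density)

lemmas integrable_R_noise_power = integrable_R_snd(1)[OF integrable_noise_power]

lemma nn_integral_channel:
  fixes G :: "real \<Rightarrow> real \<Rightarrow> ennreal"
  assumes [measurable]: "case_prod G \<in> borel_measurable (borel \<Otimes>\<^sub>M borel)"
  shows "(\<integral>\<^sup>+w. G (fst w) (r * fst w + snd w) \<partial>R)
      = (\<integral>\<^sup>+y. \<integral>\<^sup>+x. G x y * ennreal (std_normal_density (y - r * x)) \<partial>P \<partial>lborel)"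
proof -
  have "(\<integral>\<^sup>+w. G (fst w) (r * fst w + snd w) \<partial>R)
      = (\<integral>\<^sup>+w. G (fst w) (snd w) \<partial>distr R (P \<Otimes>\<^sub>M lborel) (\<lambda>w. (fst w, r * fst w + snd w)))"
    by (subst nn_integral_distr) (auto simp: case_prod_unfold)
  also have "\<dots> = (\<integral>\<^sup>+w. G (fst w) (snd w) * ennreal (std_normal_density (snd w - r * fst w)) \<partial>(P \<Otimes>\<^sub>M lborel))"
    by (simp add: distr_channel nn_integral_density case_prod_unfold mult.commute)
  also have "\<dots> = (\<integral>\<^sup>+y. \<integral>\<^sup>+x. G x y * ennreal (std_normal_density (y - r * x)) \<partial>P \<partial>lborel)"
    by (subst PL.nn_integral_snd[symmetric]) (auto simp: case_prod_unfold)
  finally show ?thesis .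
qed

text \<open>Once input and output are fixed, the noise is \<open>y - r * x\<close>, so integrating
  out the input first turns the factor \<open>snd w ^ k\<close> into \<open>mom k\<close>. Even
  \<open>k\<close> keeps \<open>ennreal\<close> from truncating.\<close>

lemma nn_integral_output:
  assumes [measurable]: "h \<in> borel_measurable borel" and k: "k \<le> 2" "even k"
  shows "(\<integral>\<^sup>+w. h (r * fst w + snd w) * ennreal (snd w ^ k) \<partial>R) = (\<integral>\<^sup>+y. h y * ennreal (mom k r y) \<partial>lborel)"
proof -
  have "(\<integral>\<^sup>+w. h (r * fst w + snd w) * ennreal (snd w ^ k) \<partial>R)
      = (\<integral>\<^sup>+w. (\<lambda>x y. h y * ennreal ((y - r * x) ^ k)) (fst w) (r * fst w + snd w) \<partial>R)"
    by simp
  also have "\<dots> = (\<integral>\<^sup>+y. \<integral>\<^sup>+x. h y * ennreal ((y - r * x) ^ k) * ennreal (std_normal_density (y - r * x)) \<partial>P \<partial>lborel)"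
    by (rule nn_integral_channel) measurable
  also have "\<dots> = (\<integral>\<^sup>+y. h y * (\<integral>\<^sup>+x. ennreal ((y - r * x) ^ k * std_normal_density (y - r * x)) \<partial>P) \<partial>lborel)"
    by (simp add: nn_integral_cmult mult.assoc ennreal_mult' flip: ennreal_mult'')
  also have "\<dots> = (\<integral>\<^sup>+y. h y * ennreal (mom k r y) \<partial>lborel)"
    unfolding mom_def using k
    by (intro nn_integral_cong, subst nn_integral_eq_integral)
       (auto intro!: integrable_mom simp: zero_le_even_power)
  finally show ?thesis .
qed

lemma integral_channel:
  fixes G :: "real \<Rightarrow> real \<Rightarrow> real"
  assumes [measurable]: "case_prod G \<in> borel_measurable (borel \<Otimes>\<^sub>M borel)"
  shows "integrable R (\<lambda>w. G (fst w) (r * fst w + snd w))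
      \<longleftrightarrow> integrable (P \<Otimes>\<^sub>M lborel) (\<lambda>w. std_normal_density (snd w - r * fst w) * G (fst w) (snd w))"
    and "(\<integral>w. G (fst w) (r * fst w + snd w) \<partial>R)
      = (\<integral>w. std_normal_density (snd w - r * fst w) * G (fst w) (snd w) \<partial>(P \<Otimes>\<^sub>M lborel))"
proof -
  let ?D = "distr R (P \<Otimes>\<^sub>M lborel) (\<lambda>w. (fst w, r * fst w + snd w))"
  have "integrable R (\<lambda>w. G (fst w) (r * fst w + snd w)) \<longleftrightarrow> integrable ?D (\<lambda>w. G (fst w) (snd w))"
    by (subst integrable_distr_eq) (auto simp: case_prod_unfold)
  also have "\<dots> \<longleftrightarrow> integrable (P \<Otimes>\<^sub>M lborel) (\<lambda>w. std_normal_density (snd w - r * fst w) * G (fst w) (snd w))"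
    by (simp add: distr_channel integrable_real_density case_prod_unfold)
  finally show "integrable R (\<lambda>w. G (fst w) (r * fst w + snd w)) \<longleftrightarrow> \<dots>" .
  have "(\<integral>w. G (fst w) (r * fst w + snd w) \<partial>R) = (\<integral>w. G (fst w) (snd w) \<partial>?D)"
    by (subst integral_distr) (auto simp: case_prod_unfold)
  also have "\<dots> = (\<integral>w. std_normal_density (snd w - r * fst w) * G (fst w) (snd w) \<partial>(P \<Otimes>\<^sub>M lborel))"
    by (simp add: distr_channel integral_real_density case_prod_unfold)
  finally show "(\<integral>w. G (fst w) (r * fst w + snd w) \<partial>R) = \<dots>" .
qed

text \<open>Signed counterpart of \<open>nn_integral_output\<close>, wanted for
  \<open>k = 1\<close>; integrability justifies the exchange of integrals.\<close>

lemma integral_output: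
  fixes h :: "real \<Rightarrow> real"
  assumes [measurable]: "h \<in> borel_measurable borel"
    and int: "integrable R (\<lambda>w. h (r * fst w + snd w) * snd w ^ k)"
  shows "(\<integral>w. h (r * fst w + snd w) * snd w ^ k \<partial>R) = (\<integral>y. h y * mom k r y \<partial>lborel)"
proof -
  let ?G = "\<lambda>x y. h y * (y - r * x) ^ k"
  have [measurable]: "case_prod ?G \<in> borel_measurable (borel \<Otimes>\<^sub>M borel)"
    by measurable
  have "integrable R (\<lambda>w. ?G (fst w) (r * fst w + snd w))"
    using int by simp
  then have int': "integrable (P \<Otimes>\<^sub>M lborel) (\<lambda>(x, y). std_normal_density (y - r * x) * ?G x y)"
    by (subst (asm) integral_channel) (auto simp: case_prod_unfold)
  have "(\<integral>w. h (r * fst w + snd w) * snd w ^ k \<partial>R) = (\<integral>w. ?G (fst w) (r * fst w + snd w) \<partial>R)"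
    by simp
  also have "\<dots> = (\<integral>w. std_normal_density (snd w - r * fst w) * ?G (fst w) (snd w) \<partial>(P \<Otimes>\<^sub>M lborel))"
    by (rule integral_channel) measurable
  also have "\<dots> = (\<integral>y. \<integral>x. std_normal_density (y - r * x) * ?G x y \<partial>P \<partial>lborel)"
    using PL.integral_snd[OF int'] by (simp add: case_prod_unfold)
  also have "\<dots> = (\<integral>y. h y * mom k r y \<partial>lborel)"
    unfolding mom_def by (simp flip: integral_mult_right_zero add: ac_simps)
  finally show ?thesis .
qed

text \<open>The total mass of \<open>mom k\<close> is the \<open>k\<close>-th moment of the noise,
  and the moments of order 0 and 2 are both 1.\<close>

lemma nn_integral_mom:
  assumes "k \<le> 2" "even k"
  shows "(\<integral>\<^sup>+y. ennreal (mom k r y) \<partial>lborel) = 1"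
proof -
  have "(\<integral>\<^sup>+y. ennreal (mom k r y) \<partial>lborel) = (\<integral>\<^sup>+w. ennreal (snd w ^ k) \<partial>R)"
    using nn_integral_output[of "\<lambda>_. 1" k r] assms by simp
  also have "\<dots> = ennreal (\<integral>w. snd w ^ k \<partial>R)"
    using assms by (intro nn_integral_eq_integral integrable_R_noise_power) (auto simp: zero_le_even_power)
  also have "(\<integral>w. snd w ^ k \<partial>R) = 1"
  proof -
    have "k = 0 \<or> k = 2"
      using assms by (auto simp: le_Suc_eq numeral_2_eq_2)
    then show ?thesis
      using integrable_R_snd(2)[OF integrable_noise_power, of k] noise.prob_space
      by (auto simp: integral_noise)
  qed
  finally show ?thesis
    by simp
qed

lemma lborel_integral_mom:
  assumes "k \<le> 2" "even k"
  shows "integrable lborel (mom k r)" "(\<integral>y. mom k r y \<partial>lborel) = 1"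
proof -
  have "has_bochner_integral lborel (mom k r) 1"
    by (rule has_bochner_integral_nn_integral) (use assms nn_integral_mom in \<open>auto simp: mom_nonneg\<close>)
  then show "integrable lborel (mom k r)" "(\<integral>y. mom k r y \<partial>lborel) = 1"
    by (auto simp: has_bochner_integral_iff)
qed

section \<open>Estimating the noise from the output, and the Fisher information\<close>

definition noise_estimate :: "real \<Rightarrow> real \<Rightarrow> real" where
  "noise_estimate r y = mom 1 r y / mom 0 r y"

lemma borel_measurable_noise_estimate [measurable (raw)]:
  assumes [measurable]: "f \<in> borel_measurable M" "g \<in> borel_measurable M"
  shows "(\<lambda>w. noise_estimate (f w) (g w)) \<in> borel_measurable M"
  unfolding noise_estimate_def by measurable

text \<open>The Fisher information of the output, since \<open>mom 1 r = - (mom 0 r)'\<close>.\<close>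

definition J :: "real \<Rightarrow> real" where
  "J r = (\<integral>y. (mom 1 r y)\<^sup>2 / mom 0 r y \<partial>lborel)"

lemma mom_1_square_div_le: "(mom 1 r y)\<^sup>2 / mom 0 r y \<le> mom 2 r y"
  using mom_1_square_le[of r y] by (simp add: divide_le_eq mult.commute)

lemma mom_1_square_div_nonneg: "0 \<le> (mom 1 r y)\<^sup>2 / mom 0 r y"
  by (simp add: less_imp_le)

lemma integrable_mom_1_square_div: "integrable lborel (\<lambda>y. (mom 1 r y)\<^sup>2 / mom 0 r y)"
proof (rule Bochner_Integration.integrable_bound)
  show "integrable lborel (mom 2 r)"
    by (rule lborel_integral_mom) auto
  show "AE y in lborel. norm ((mom 1 r y)\<^sup>2 / mom 0 r y) \<le> norm (mom 2 r y)"
    using mom_1_square_div_le mom_1_square_div_nonneg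
    by (intro AE_I2) (metis abs_of_nonneg order_trans real_norm_def)
qed auto

lemma J_le_1: "J r \<le> 1"
proof -
  have "J r \<le> (\<integral>y. mom 2 r y \<partial>lborel)"
    unfolding J_def
    by (rule integral_mono[OF integrable_mom_1_square_div lborel_integral_mom(1)])
       (use mom_1_square_div_le in auto)
  then show ?thesis
    by (simp add: lborel_integral_mom)
qed

text \<open>Against the output density \<open>mom 0 r\<close>, the square of
  \<open>mom 1 r / mom 0 r\<close> becomes the integrand that defines \<open>J\<close>.\<close>

lemma noise_estimate_square:
  "integrable R (\<lambda>w. (noise_estimate r (r * fst w + snd w))\<^sup>2)"
  "(\<integral>w. (noise_estimate r (r * fst w + snd w))\<^sup>2 \<partial>R) = J r"
proof -
  have "(\<integral>\<^sup>+w. ennreal ((noise_estimate r (r * fst w + snd w))\<^sup>2) \<partial>R)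
      = (\<integral>\<^sup>+y. ennreal ((noise_estimate r y)\<^sup>2) * ennreal (mom 0 r y) \<partial>lborel)"
    using nn_integral_output[of "\<lambda>y. ennreal ((noise_estimate r y)\<^sup>2)" 0 r] by simp
  also have "\<dots> = (\<integral>\<^sup>+y. ennreal ((mom 1 r y)\<^sup>2 / mom 0 r y) \<partial>lborel)"
    by (simp add: noise_estimate_def power2_eq_square less_imp_le flip: ennreal_mult'')
  also have "\<dots> = ennreal (J r)"
    unfolding J_def
    by (intro nn_integral_eq_integral integrable_mom_1_square_div AE_I2 mom_1_square_div_nonneg)
  finally have *: "(\<integral>\<^sup>+w. ennreal ((noise_estimate r (r * fst w + snd w))\<^sup>2) \<partial>R) = ennreal (J r)" .
  have "0 \<le> J r"
    unfolding J_def by (intro integral_nonneg_AE AE_I2 mom_1_square_div_nonneg)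
  with * have "has_bochner_integral R (\<lambda>w. (noise_estimate r (r * fst w + snd w))\<^sup>2) (J r)"
    by (intro has_bochner_integral_nn_integral) auto
  then show "integrable R (\<lambda>w. (noise_estimate r (r * fst w + snd w))\<^sup>2)"
    "(\<integral>w. (noise_estimate r (r * fst w + snd w))\<^sup>2 \<partial>R) = J r"
    by (auto simp: has_bochner_integral_iff)
qed

text \<open>The integrands of \<open>J\<close> are dominated by \<open>mom 2\<close>, which varies with \<open>r\<close> but has constant integral, so it
  converges in \<open>L\<^sup>1\<close> by Scheffe's argument.\<close>

lemma tendsto_J:
  assumes s: "s \<longlonglongrightarrow> r"
  shows "(\<lambda>i. J (s i)) \<longlonglongrightarrow> J r"
proof -
  let ?j = "\<lambda>r y. (mom 1 r y)\<^sup>2 / mom 0 r y"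
  note im = lborel_integral_mom[of 2, simplified]
  have j: "0 \<le> ?j r y" "?j r y \<le> mom 2 r y" for r y
    using mom_1_square_div_nonneg mom_1_square_div_le by auto
  have m: "(\<lambda>i. mom k (s i) y) \<longlonglongrightarrow> mom k r y" if "k \<le> 2" for k y
    by (rule tendsto_mom[OF that s])
  have jlim: "(\<lambda>i. ?j (s i) y) \<longlonglongrightarrow> ?j r y" for y
    by (intro tendsto_intros m) auto
  \<comment> \<open>Capping by the limit \<open>mom 2 r\<close> supplies a dominating function that
    does not move with \<open>i\<close>; at \<open>r\<close> itself the cap is inactive.\<close>
  have min: "(\<lambda>i. \<integral>y. min (?j (s i) y) (mom 2 r y) \<partial>lborel) \<longlonglongrightarrow> (\<integral>y. min (?j r y) (mom 2 r y) \<partial>lborel)"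
  proof (rule integral_dominated_convergence[where w="mom 2 r"])
    show "AE y in lborel. (\<lambda>i. min (?j (s i) y) (mom 2 r y)) \<longlonglongrightarrow> min (?j r y) (mom 2 r y)"
      by (intro AE_I2 tendsto_min jlim tendsto_const)
    show "AE y in lborel. norm (min (?j (s i) y) (mom 2 r y)) \<le> mom 2 r y" for i
      using j mom_nonneg[of 2] by (intro AE_I2) (auto simp: min_def)
  qed (use im in auto)
  have scheffe: "(\<lambda>i. \<integral>y. \<bar>mom 2 (s i) y - mom 2 r y\<bar> \<partial>lborel) \<longlonglongrightarrow> 0"
  proof -
    have "(\<lambda>i. \<integral>y. mom 2 r y - min (mom 2 (s i) y) (mom 2 r y) \<partial>lborel) \<longlonglongrightarrow> integral\<^sup>L lborel (\<lambda>_::real. 0)"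
    proof (rule integral_dominated_convergence[where w="mom 2 r"])
      have "(\<lambda>i. mom 2 r y - min (mom 2 (s i) y) (mom 2 r y)) \<longlonglongrightarrow> mom 2 r y - min (mom 2 r y) (mom 2 r y)" for y
        by (intro tendsto_intros tendsto_min m) auto
      then show "AE y in lborel. (\<lambda>i. mom 2 r y - min (mom 2 (s i) y) (mom 2 r y)) \<longlonglongrightarrow> 0"
        by simp
      show "AE y in lborel. norm (mom 2 r y - min (mom 2 (s i) y) (mom 2 r y)) \<le> mom 2 r y" for i
        using mom_nonneg[of 2] by (intro AE_I2) (auto simp: min_def)
    qed (use im in auto)
    \<comment> \<open>In \<open>\<bar>a - b\<bar> = 2 * (b - min a b) + (a - b)\<close> the last
      term integrates to 0, because both masses are 1.\<close>
    moreover have "(\<integral>y. \<bar>mom 2 (s i) y - mom 2 r y\<bar> \<partial>lborel)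
        = 2 * (\<integral>y. mom 2 r y - min (mom 2 (s i) y) (mom 2 r y) \<partial>lborel)" for i
    proof -
      have "(\<lambda>y. \<bar>mom 2 (s i) y - mom 2 r y\<bar>)
        = (\<lambda>y. 2 * (mom 2 r y - min (mom 2 (s i) y) (mom 2 r y)) + (mom 2 (s i) y - mom 2 r y))"
        by (auto simp: min_def abs_if fun_eq_iff)
      then show ?thesis
        using im by simp
    qed
    ultimately show ?thesis
      by (auto intro!: tendsto_eq_intros)
  qed
  \<comment> \<open>What the cap removes is at most
    \<open>\<bar>mom 2 (s i) y - mom 2 r y\<bar>\<close>, because the uncapped integrand stays below
    \<open>mom 2 (s i) y\<close>.\<close>
  have "(\<lambda>i. J (s i) - (\<integral>y. min (?j (s i) y) (mom 2 r y) \<partial>lborel)) \<longlonglongrightarrow> 0"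
  proof (rule tendsto_sandwich[OF _ _ tendsto_const scheffe])
    have eq: "J (s i) - (\<integral>y. min (?j (s i) y) (mom 2 r y) \<partial>lborel)
        = (\<integral>y. ?j (s i) y - min (?j (s i) y) (mom 2 r y) \<partial>lborel)" for i
      unfolding J_def using im integrable_mom_1_square_div by simp
    show "\<forall>\<^sub>F i in sequentially. 0 \<le> J (s i) - (\<integral>y. min (?j (s i) y) (mom 2 r y) \<partial>lborel)"
      unfolding eq by (intro always_eventually allI integral_nonneg_AE AE_I2) simp
    show "\<forall>\<^sub>F i in sequentially. J (s i) - (\<integral>y. min (?j (s i) y) (mom 2 r y) \<partial>lborel)
        \<le> (\<integral>y. \<bar>mom 2 (s i) y - mom 2 r y\<bar> \<partial>lborel)"
      unfolding eq
    proof (intro always_eventually allI integral_mono)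
      fix i y
      show "?j (s i) y - min (?j (s i) y) (mom 2 r y) \<le> \<bar>mom 2 (s i) y - mom 2 r y\<bar>"
        using j(2)[of "s i" y] by (auto simp: min_def)
    qed (use im integrable_mom_1_square_div in auto)
  qed
  from tendsto_add[OF this min] show ?thesis
    using j by (simp add: J_def min_absorb1)
qed

lemma continuous_on_J: "continuous_on S J"
  unfolding continuous_on_sequentially by (auto simp: comp_def intro: tendsto_J)

text \<open>Both integrals equal that of \<open>h * mom 1 r\<close>, since
  \<open>noise_estimate * mom 0 = mom 1\<close>. This identifies \<open>noise_estimate\<close> as
  the conditional expectation of the noise, tested against square integrable functions of the
  output.\<close>

lemma noise_estimate_orthogonal:
  fixes h :: "real \<Rightarrow> real"
  assumes [measurable]: "h \<in> borel_measurable borel"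
    and h: "integrable R (\<lambda>w. (h (r * fst w + snd w))\<^sup>2)"
  shows "integrable R (\<lambda>w. h (r * fst w + snd w) * snd w)"
    and "integrable R (\<lambda>w. h (r * fst w + snd w) * noise_estimate r (r * fst w + snd w))"
    and "(\<integral>w. h (r * fst w + snd w) * snd w \<partial>R)
       = (\<integral>w. h (r * fst w + snd w) * noise_estimate r (r * fst w + snd w) \<partial>R)"
proof -
  have prod: "integrable R (\<lambda>w. a w * b w)"
    if [measurable]: "a \<in> borel_measurable R" "b \<in> borel_measurable R"
      and "integrable R (\<lambda>w. (a w)\<^sup>2)" "integrable R (\<lambda>w. (b w)\<^sup>2)" for a b :: "real \<times> real \<Rightarrow> real"
  proof (rule Bochner_Integration.integrable_bound)
    show "integrable R (\<lambda>w. (a w)\<^sup>2 + (b w)\<^sup>2)"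
      using that by simp
    have "\<bar>a w\<bar> * \<bar>b w\<bar> \<le> (a w)\<^sup>2 + (b w)\<^sup>2" for w
      using sum_squares_bound[of "\<bar>a w\<bar>" "\<bar>b w\<bar>"] by (simp add: mult.assoc)
        (smt (verit) mult_nonneg_nonneg)
    then show "AE w in R. norm (a w * b w) \<le> norm ((a w)\<^sup>2 + (b w)\<^sup>2)"
      by (simp add: abs_mult)
  qed measurable
  show 1: "integrable R (\<lambda>w. h (r * fst w + snd w) * snd w)"
    by (rule prod) (use h integrable_R_noise_power in auto)
  show 2: "integrable R (\<lambda>w. h (r * fst w + snd w) * noise_estimate r (r * fst w + snd w))"
    by (rule prod) (use h noise_estimate_square in auto)
  have "(\<integral>w. h (r * fst w + snd w) * snd w \<partial>R) = (\<integral>y. h y * mom 1 r y \<partial>lborel)"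
    using integral_output[of h r 1] 1 by simp
  also have "\<dots> = (\<integral>y. h y * noise_estimate r y * mom 0 r y \<partial>lborel)"
    by (simp add: noise_estimate_def)
  also have "\<dots> = (\<integral>w. h (r * fst w + snd w) * noise_estimate r (r * fst w + snd w) \<partial>R)"
    using integral_output[of "\<lambda>y. h y * noise_estimate r y" r 0] 2 by simp
  finally show "(\<integral>w. h (r * fst w + snd w) * snd w \<partial>R) = \<dots>" .
qed

text \<open>The orthogonality relation with \<open>h = noise_estimate r\<close>.\<close>

lemma noise_estimate_times_noise:
  "integrable R (\<lambda>w. noise_estimate r (r * fst w + snd w) * snd w)"
  "(\<integral>w. noise_estimate r (r * fst w + snd w) * snd w \<partial>R) = J r"
proof -
  have [measurable]: "noise_estimate r \<in> borel_measurable borel"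
    by measurable
  note * = noise_estimate_orthogonal[OF this noise_estimate_square(1)]
  show "integrable R (\<lambda>w. noise_estimate r (r * fst w + snd w) * snd w)"
    by (rule *)
  show "(\<integral>w. noise_estimate r (r * fst w + snd w) * snd w \<partial>R) = J r"
    unfolding *(3) noise_estimate_square(2)[symmetric] power2_eq_square ..
qed

text \<open>Expanding the square gives \<open>J r - 2 * J r + 1\<close>.\<close>

lemma noise_mmse:
  "(\<integral>w. (noise_estimate r (r * fst w + snd w) - snd w)\<^sup>2 \<partial>R) = 1 - J r"
proof -
  have "(\<lambda>w. (noise_estimate r (r * fst w + snd w) - snd w)\<^sup>2)
    = (\<lambda>w. (noise_estimate r (r * fst w + snd w))\<^sup>2
        - 2 * (noise_estimate r (r * fst w + snd w) * snd w) + (snd w)\<^sup>2)"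
    by (simp add: power2_eq_square algebra_simps fun_eq_iff)
  then show ?thesis
    using noise_estimate_square[of r] noise_estimate_times_noise[of r]
      integrable_R_noise_power[of 2] integrable_R_snd(2)[OF integrable_noise_power, of 2]
    by (simp add: integral_noise)
qed

section \<open>The derivative of the output log density along a path\<close>

text \<open>The derivative found in \<open>has_real_derivative_log_output\<close>, written with
  noise moments only. At \<open>r = 0\<close> division by zero makes it 0.\<close>

definition slope :: "real \<Rightarrow> real \<times> real \<Rightarrow> real" where
  "slope r w = (snd w * mom 1 r (r * fst w + snd w) - mom 2 r (r * fst w + snd w))
     / (r * mom 0 r (r * fst w + snd w))"

lemma borel_measurable_slope [measurable (raw)]:
  assumes [measurable]: "f \<in> borel_measurable M"
    "(\<lambda>w. fst (g w)) \<in> borel_measurable M" "(\<lambda>w. snd (g w)) \<in> borel_measurable M"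
  shows "(\<lambda>w. slope (f w) (g w)) \<in> borel_measurable M"
  unfolding slope_def by measurable

text \<open>The conditional second moment \<open>?k\<close> has expectation 1, and the noise times
  its estimate has expectation \<open>J r\<close>. For the absolute value,
  \<open>\<bar>e * z\<bar> \<le> (e\<^sup>2 + z\<^sup>2) / 2\<close> gives the bound
  \<open>((J r + 1) / 2 + 1) / \<bar>r\<bar>\<close>, and \<open>J r \<le> 1\<close>.\<close>

lemma integral_slope:
  "integrable R (slope r)"
  "(\<integral>w. slope r w \<partial>R) = (J r - 1) / r"
  "(\<integral>w. \<bar>slope r w\<bar> \<partial>R) \<le> 2 / \<bar>r\<bar>"
proof -
  let ?Y = "\<lambda>w::real \<times> real. r * fst w + snd w"
  let ?k = "\<lambda>w. mom 2 r (?Y w) / mom 0 r (?Y w)" and ?e = "\<lambda>w. noise_estimate r (?Y w) * snd w"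
  have eq: "slope r = (\<lambda>w. (?e w - ?k w) / r)"
    by (simp add: slope_def noise_estimate_def fun_eq_iff diff_divide_distrib mult.commute)
  have k0: "0 \<le> ?k w" for w
    by (intro divide_nonneg_nonneg mom_nonneg) auto
  have "(\<integral>\<^sup>+w. ennreal (?k w) \<partial>R) = (\<integral>\<^sup>+y. ennreal (mom 2 r y / mom 0 r y) * ennreal (mom 0 r y) \<partial>lborel)"
    using nn_integral_output[of "\<lambda>y. ennreal (mom 2 r y / mom 0 r y)" 0 r] by simp
  also have "\<dots> = 1"
    using nn_integral_mom[of 2 r] by (simp add: less_imp_le mom_nonneg flip: ennreal_mult'')
  finally have "has_bochner_integral R ?k 1"
    by (intro has_bochner_integral_nn_integral) (use k0 in auto)
  then have k: "integrable R ?k" "(\<integral>w. ?k w \<partial>R) = 1"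
    by (auto simp: has_bochner_integral_iff)
  show "integrable R (slope r)" "(\<integral>w. slope r w \<partial>R) = (J r - 1) / r"
    using k noise_estimate_times_noise[of r] by (simp_all add: eq)
  have "(\<integral>w. \<bar>slope r w\<bar> \<partial>R)
      \<le> (\<integral>w. (((noise_estimate r (?Y w))\<^sup>2 + (snd w)\<^sup>2) / 2 + ?k w) / \<bar>r\<bar> \<partial>R)"
  proof (rule integral_mono)
    fix w
    have "\<bar>?e w\<bar> \<le> ((noise_estimate r (?Y w))\<^sup>2 + (snd w)\<^sup>2) / 2"
      using sum_squares_bound[of "\<bar>noise_estimate r (?Y w)\<bar>" "\<bar>snd w\<bar>"] by (simp add: abs_mult)
    with k0[of w] have "\<bar>?e w - ?k w\<bar> \<le> ((noise_estimate r (?Y w))\<^sup>2 + (snd w)\<^sup>2) / 2 + ?k w"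
      by linarith
    then show "\<bar>slope r w\<bar> \<le> (((noise_estimate r (?Y w))\<^sup>2 + (snd w)\<^sup>2) / 2 + ?k w) / \<bar>r\<bar>"
      by (simp add: eq divide_right_mono)
  qed (use k noise_estimate_times_noise[of r] noise_estimate_square[of r] integrable_R_noise_power[of 2]
        in \<open>simp_all add: eq\<close>)
  also have "\<dots> = ((J r + 1) / 2 + 1) / \<bar>r\<bar>"
    using k noise_estimate_square[of r] integrable_R_noise_power[of 2]
      integrable_R_snd(2)[OF integrable_noise_power, of 2]
    by (simp add: integral_noise)
  also have "\<dots> \<le> 2 / \<bar>r\<bar>"
    using J_le_1[of r] by (intro divide_right_mono) auto
  finally show "(\<integral>w. \<bar>slope r w\<bar> \<partial>R) \<le> 2 / \<bar>r\<bar>" .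
qed

text \<open>The point \<open>w\<close> of input and noise stays fixed, so \<open>r\<close> moves
  both the density and the place where it is evaluated.\<close>

definition log_output :: "real \<Rightarrow> real \<times> real \<Rightarrow> real" where
  "log_output r w = ln (mom 0 r (r * fst w + snd w))"

lemma borel_measurable_log_output [measurable (raw)]:
  assumes [measurable]: "f \<in> borel_measurable M"
    "(\<lambda>w. fst (g w)) \<in> borel_measurable M" "(\<lambda>w. snd (g w)) \<in> borel_measurable M"
  shows "(\<lambda>w. log_output (f w) (g w)) \<in> borel_measurable M"
  unfolding log_output_def by (rule borel_measurable_ln) measurable

text \<open>Along the path the noise density is evaluated at \<open>u = z + r * (x - x')\<close>,
  and the integrand has the derivative \<open>- (u * n u) * (x - x')\<close>. Its bound
  \<open>\<bar>x - x'\<bar>\<close> is integrable by the first moment of the input.\<close>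

lemma has_real_derivative_log_output:
  assumes "r \<noteq> 0"
  shows "((\<lambda>r. log_output r w) has_real_derivative slope r w) (at r)"
proof -
  define x z where "x = fst w" and "z = snd w"
  let ?n = std_normal_density
  let ?u = "\<lambda>r x'. z + r * (x - x')"
  let ?y = "r * x + z"
  have "((\<lambda>r. \<integral>x'. ?n (?u r x') \<partial>P) has_real_derivative
      (\<integral>x'. - (?u r x' * ?n (?u r x')) * (x - x') \<partial>P)) (at r)"
  proof (rule has_real_derivative_lebesgue_integral[where w="\<lambda>x'. \<bar>x - x'\<bar>"])
    show "integrable P (\<lambda>x'. ?n (?u t x'))" for t
      using integrable_mom[of 0 "t * x + z" t] by (simp add: algebra_simps)
    show "((\<lambda>t. ?n (?u t x')) has_real_derivative - (?u t x' * ?n (?u t x')) * (x - x')) (at t)" for t x'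
      by (rule DERIV_cong[OF DERIV_chain2[OF has_real_derivative_std_normal_density]])
         (auto intro!: derivative_eq_intros)
    show "\<bar>- (?u t x' * ?n (?u t x')) * (x - x')\<bar> \<le> \<bar>x - x'\<bar>" for t x'
      using std_normal_moment_le_1[of 1 "?u t x'"] by (simp add: abs_mult mult_left_le_one_le)
    show "integrable P (\<lambda>x'. \<bar>x - x'\<bar>)"
      using integrable_input by simp
  qed measurable
  also have "(\<lambda>r. \<integral>x'. ?n (?u r x') \<partial>P) = (\<lambda>r. mom 0 r (r * x + z))"
    by (simp add: mom_def algebra_simps)
  \<comment> \<open>Substituting \<open>x - x' = (u - z) / r\<close> leaves only the integrands of
    \<open>mom 1\<close> and \<open>mom 2\<close>.\<close>
  also have "(\<integral>x'. - (?u r x' * ?n (?u r x')) * (x - x') \<partial>P)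
      = (\<integral>x'. (z * ((?y - r * x') ^ 1 * ?n (?y - r * x')) - (?y - r * x')\<^sup>2 * ?n (?y - r * x')) / r \<partial>P)"
  proof (rule Bochner_Integration.integral_cong[OF refl])
    fix x'
    have "?u r x' = ?y - r * x'"
      by (simp add: algebra_simps)
    moreover have "?y - r * x' - z = r * (x - x')"
      by (simp add: algebra_simps)
    then have "x - x' = (?y - r * x' - z) / r"
      using assms by simp
    ultimately show "- (?u r x' * ?n (?u r x')) * (x - x')
      = (z * ((?y - r * x') ^ 1 * ?n (?y - r * x')) - (?y - r * x')\<^sup>2 * ?n (?y - r * x')) / r"
      using assms by (simp only:) (simp add: power2_eq_square field_simps)
  qed
  also have "\<dots> = (z * mom 1 r ?y - mom 2 r ?y) / r"
    unfolding mom_def using integrable_mom[of 1 ?y r] integrable_mom[of 2 ?y r] by simp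
  finally have "((\<lambda>r. mom 0 r (r * x + z)) has_real_derivative (z * mom 1 r ?y - mom 2 r ?y) / r) (at r)" .
  from DERIV_chain2[where f=ln, OF DERIV_ln[OF mom_0_pos] this]
  show ?thesis
    unfolding log_output_def slope_def x_def z_def by (simp add: field_simps)
qed

text \<open>Gibbs' inequality against a Cauchy density: this needs only a first moment of the output.\<close>

lemma integrable_log_output: "integrable R (log_output r)"
proof -
  let ?Y = "\<lambda>w::real \<times> real. r * fst w + snd w"
  let ?q = "\<lambda>y::real. inverse (1 + y\<^sup>2)"
  have q0: "0 < ?q y" for y
    by (simp add: add_pos_nonneg)
  have intq: "integrable lborel ?q"
    using integrable_inverse_1_plus_square by (simp add: set_integrable_def)
  \<comment> \<open>The ratio of the Cauchy weight to the output density has as expectation the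
    total mass of the weight, which is finite.\<close>
  have "(\<integral>\<^sup>+w. ennreal (?q (?Y w) / mom 0 r (?Y w)) \<partial>R)
      = (\<integral>\<^sup>+y. ennreal (?q y / mom 0 r y) * ennreal (mom 0 r y) \<partial>lborel)"
    using nn_integral_output[of "\<lambda>y. ennreal (?q y / mom 0 r y)" 0 r] by simp
  also have "\<dots> = (\<integral>\<^sup>+y. ennreal (?q y) \<partial>lborel)"
    by (simp add: less_imp_le flip: ennreal_mult'')
  also have "\<dots> = ennreal (\<integral>y. ?q y \<partial>lborel)"
    by (rule nn_integral_eq_integral[OF intq]) (use q0 in \<open>auto simp: less_imp_le\<close>)
  finally have "has_bochner_integral R (\<lambda>w. ?q (?Y w) / mom 0 r (?Y w)) (\<integral>y. ?q y \<partial>lborel)"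
    using q0 by (intro has_bochner_integral_nn_integral integral_nonneg_AE)
      (auto intro!: AE_I2 simp: less_imp_le)
  then have int: "integrable R (\<lambda>w. ?q (?Y w) / mom 0 r (?Y w))"
    by (auto simp: has_bochner_integral_iff)
  show ?thesis
  proof (rule Bochner_Integration.integrable_bound)
    show "integrable R (\<lambda>w. ?q (?Y w) / mom 0 r (?Y w) + 2 * (\<bar>r\<bar> * \<bar>fst w\<bar> + \<bar>snd w\<bar>))"
      using int integrable_R_fst(1)[OF integrable_input] integrable_R_noise_power[of 1] by simp
    show "AE w in R. norm (log_output r w)
        \<le> norm (?q (?Y w) / mom 0 r (?Y w) + 2 * (\<bar>r\<bar> * \<bar>fst w\<bar> + \<bar>snd w\<bar>))"
    proof (rule AE_I2)
      fix w
      define y where "y = ?Y w"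
      have "mom 0 r y \<le> (\<integral>x. 1 \<partial>P)"
        unfolding mom_def
        by (rule integral_mono) (use integrable_mom[of 0 y r] std_normal_moment_le_1[of 0] in auto)
      then have "ln (mom 0 r y) \<le> 0"
        by (simp add: prob_space[simplified])
      \<comment> \<open>This is \<open>ln a \<le> a - 1\<close> at
        \<open>a = ?q y / mom 0 r y\<close>, with
        \<open>- ln (?q y) = ln (1 + y\<^sup>2) \<le> 2 * \<bar>y\<bar>\<close>.\<close>
      moreover have "- ln (mom 0 r y) \<le> ?q y / mom 0 r y + 2 * \<bar>y\<bar>"
      proof -
        have "ln (?q y / mom 0 r y) \<le> ?q y / mom 0 r y - 1"
          using q0[of y] by (intro ln_le_minus_one) simp
        moreover have "ln (?q y / mom 0 r y) = ln (?q y) - ln (mom 0 r y)"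
          by (rule ln_divide_pos[OF q0 mom_0_pos])
        moreover have "ln (?q y) = - ln (1 + y\<^sup>2)"
          by (intro ln_inverse) 
        moreover have "ln (1 + y\<^sup>2) \<le> 2 * \<bar>y\<bar>"
        proof -
          have "1 + y\<^sup>2 \<le> (1 + \<bar>y\<bar>)\<^sup>2"
            by (simp add: power2_eq_square algebra_simps)
          then have "ln (1 + y\<^sup>2) \<le> ln ((1 + \<bar>y\<bar>)\<^sup>2)"
            by (subst ln_le_cancel_iff) (auto intro: add_pos_nonneg zero_less_power)
          also have "\<dots> = 2 * ln (1 + \<bar>y\<bar>)"
            by (simp add: ln_realpow)
          also have "\<dots> \<le> 2 * \<bar>y\<bar>"
            by (simp add: ln_add_one_self_le_self)
          finally show ?thesis .
        qed
        ultimately show ?thesis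
          by linarith
      qed
      moreover have "\<bar>y\<bar> \<le> \<bar>r\<bar> * \<bar>fst w\<bar> + \<bar>snd w\<bar>"
        unfolding y_def by (metis abs_mult abs_triangle_ineq)
      ultimately show "norm (log_output r w)
          \<le> norm (?q (?Y w) / mom 0 r (?Y w) + 2 * (\<bar>r\<bar> * \<bar>fst w\<bar> + \<bar>snd w\<bar>))"
        unfolding log_output_def y_def[symmetric] by simp
    qed
  qed measurable
qed

section \<open>Integration over the scale and the derivative of the expected log density\<close>

text \<open>The fundamental theorem of calculus holds on each path, and Fubini exchanges the
  integral over the scale with the expectation.\<close>

lemma integral_log_output_diff:
  assumes "c \<le> d" and 0: "0 \<notin> {c..d}"
  shows "(\<integral>w. log_output d w \<partial>R) - (\<integral>w. log_output c w \<partial>R) = integral {c..d} (\<lambda>r. (J r - 1) / r)"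
proof -
  interpret LR: pair_sigma_finite lborel R ..
  \<comment> \<open>The distance of the interval from 0; the expected absolute slope is then at most
    \<open>2 / m\<close> throughout.\<close>
  define m where "m = min \<bar>c\<bar> \<bar>d\<bar>"
  have m: "0 < m" "\<And>r. r \<in> {c..d} \<Longrightarrow> m \<le> \<bar>r\<bar>"
    using 0 assms(1) by (auto simp: m_def min_def abs_if split: if_splits)
  let ?f = "\<lambda>r w. indicator {c..d} r *\<^sub>R slope r w"
  have [measurable]: "case_prod ?f \<in> borel_measurable (lborel \<Otimes>\<^sub>M R)"
    unfolding case_prod_unfold by measurable
  have int: "integrable (lborel \<Otimes>\<^sub>M R) (case_prod ?f)"
  proof (rule LR.Fubini_integrable)
    show "integrable lborel (\<lambda>r. \<integral>w. norm (case (r, w) of (r, w) \<Rightarrow> ?f r w) \<partial>R)"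
    proof (rule Bochner_Integration.integrable_bound)
      show "integrable lborel (\<lambda>r. indicator {c..d} r * (2 / m))"
        by (intro integrable_mult_left integrable_real_indicator) (auto simp: emeasure_lborel_Icc_eq)
      show "AE r in lborel. norm (\<integral>w. norm (case (r, w) of (r, w) \<Rightarrow> ?f r w) \<partial>R) \<le> norm (indicator {c..d} r * (2 / m))"
      proof (rule AE_I2)
        fix r
        have "(\<integral>w. \<bar>slope r w\<bar> \<partial>R) \<le> 2 / m" if "r \<in> {c..d}"
          using integral_slope(3)[of r] divide_left_mono[of m "\<bar>r\<bar>" 2] m that by force
        then show "norm (\<integral>w. norm (case (r, w) of (r, w) \<Rightarrow> ?f r w) \<partial>R) \<le> norm (indicator {c..d} r * (2 / m))"
          using m(1) by (auto simp: indicator_def)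
      qed
    qed measurable
    show "AE r in lborel. integrable R (\<lambda>w. case (r, w) of (r, w) \<Rightarrow> ?f r w)"
      using integral_slope(1) by simp
  qed measurable
  have ftc: "((\<lambda>r. slope r w) has_integral log_output d w - log_output c w) {c..d}" for w
  proof -
    have "((\<lambda>r. log_output r w) has_vector_derivative slope r w) (at r within {c..d})" if "r \<in> {c..d}" for r
    proof -
      have "r \<noteq> 0"
        using 0 that by auto
      then have "((\<lambda>r. log_output r w) has_real_derivative slope r w) (at r within {c..d})"
        by (rule has_field_derivative_at_within[OF has_real_derivative_log_output])
      then show ?thesis
        by (simp only: has_real_derivative_iff_has_vector_derivative)
    qed
    from fundamental_theorem_of_calculus[OF assms(1) this] show ?thesis .
  qed
  \<comment> \<open>The gauge integral of the fundamental theorem agrees with the Lebesgue integral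
    on paths where the slope is absolutely integrable; Fubini provides this almost
    everywhere.\<close>
  have "AE w in R. integrable lborel (\<lambda>r. ?f r w)"
    using LR.AE_integrable_snd[OF int] .
  then have eq: "AE w in R. (\<integral>r. ?f r w \<partial>lborel) = log_output d w - log_output c w"
  proof eventually_elim
    case (elim w)
    then have "(LINT r:{c..d}|lborel. slope r w) = integral {c..d} (\<lambda>r. slope r w)"
      by (intro set_borel_integral_eq_integral) (simp add: set_integrable_def)
    also have "\<dots> = log_output d w - log_output c w"
      by (rule integral_unique[OF ftc])
    finally show ?case
      by (simp add: set_lebesgue_integral_def)
  qed
  have "(\<integral>w. log_output d w \<partial>R) - (\<integral>w. log_output c w \<partial>R) = (\<integral>w. log_output d w - log_output c w \<partial>R)"
    by (rule Bochner_Integration.integral_diff[symmetric]) (rule integrable_log_output)+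
  also have "\<dots> = (\<integral>w. \<integral>r. ?f r w \<partial>lborel \<partial>R)"
    by (rule integral_cong_AE[symmetric]) (use eq in auto)
  also have "\<dots> = (\<integral>r. \<integral>w. ?f r w \<partial>R \<partial>lborel)"
    by (rule LR.Fubini_integral[OF int])
  also have "\<dots> = (LINT r:{c..d}|lborel. (J r - 1) / r)"
    by (simp add: integral_slope set_lebesgue_integral_def)
  also have "\<dots> = integral {c..d} (\<lambda>r. (J r - 1) / r)"
    using 0 by (intro set_borel_integral_eq_integral borel_integrable_atLeastAtMost')
      (auto intro!: continuous_intros continuous_on_J)
  finally show ?thesis .
qed

text \<open>The integrand \<open>(J r - 1) / r\<close> is continuous away from 0, so its integral is
  differentiable in the upper limit.\<close>

lemma has_real_derivative_expected_log_output:
  assumes "r \<noteq> 0"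
  shows "((\<lambda>t. \<integral>w. log_output t w \<partial>R) has_real_derivative (J r - 1) / r) (at r)"
proof -
  \<comment> \<open>Half of \<open>\<bar>r\<bar>\<close> as radius keeps the interval around
    \<open>r\<close> away from 0.\<close>
  define c d where "c = r - \<bar>r\<bar> / 2" and "d = r + \<bar>r\<bar> / 2"
  have r: "r \<in> {c<..<d}" "0 \<notin> {c..d}"
    using assms by (auto simp: c_def d_def abs_if split: if_splits)
  have "((\<lambda>t. (\<integral>w. log_output c w \<partial>R) + integral {c..t} (\<lambda>r. (J r - 1) / r)) has_real_derivative
      0 + (J r - 1) / r) (at r within {c..d})"
    using r by (intro DERIV_add DERIV_const integral_has_real_derivative)
      (auto intro!: continuous_intros continuous_on_J)
  then have "((\<lambda>t. (\<integral>w. log_output c w \<partial>R) + integral {c..t} (\<lambda>r. (J r - 1) / r)) has_real_derivative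
      (J r - 1) / r) (at r)"
    using r by (simp add: at_within_Icc_at)
  then show ?thesis
  proof (rule has_field_derivative_transform_within_open[where S="{c<..<d}"])
    fix t assume "t \<in> {c<..<d}"
    then show "(\<integral>w. log_output c w \<partial>R) + integral {c..t} (\<lambda>r. (J r - 1) / r) = (\<integral>w. log_output t w \<partial>R)"
      using integral_log_output_diff[of c t] r by auto
  qed (use r in auto)
qed

section \<open>The information as a function of the scale\<close>

text \<open>The noise is \<open>y - t * x\<close>, so this is the expected log ratio of the
  conditional output density to the output density; \<open>mutual_information_eq_info\<close>
  identifies it with the mutual information.\<close>

definition info :: "real \<Rightarrow> real" where
  "info t = (\<integral>w. ln (std_normal_density (snd w)) - log_output t w \<partial>R)"

lemma integrable_ln_noise_density: "integrable R (\<lambda>w. ln (std_normal_density (snd w)))"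
  unfolding ln_std_normal_density using integrable_R_noise_power[of 2] by simp

lemma integrable_info: "integrable R (\<lambda>w. ln (std_normal_density (snd w)) - log_output t w)"
  using integrable_ln_noise_density integrable_log_output by simp

lemma has_real_derivative_info:
  assumes "r \<noteq> 0"
  shows "(info has_real_derivative (1 - J r) / r) (at r)"
proof -
  have "info = (\<lambda>t. (\<integral>w. ln (std_normal_density (snd w)) \<partial>R) - (\<integral>w. log_output t w \<partial>R))"
    unfolding info_def using integrable_ln_noise_density integrable_log_output by auto
  moreover have "((\<lambda>t. (\<integral>w. ln (std_normal_density (snd w)) \<partial>R) - (\<integral>w. log_output t w \<partial>R))
      has_real_derivative 0 - (J r - 1) / r) (at r)"
    by (intro DERIV_diff DERIV_const has_real_derivative_expected_log_output assms)
  moreover have "0 - (J r - 1) / r = (1 - J r) / r"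
    by (simp add: diff_divide_distrib)
  ultimately show ?thesis
    by (simp only:)
qed

text \<open>Jensen's inequality for the logarithm; the second moment makes the quadratic exponent
  integrable.\<close>

lemma ln_output_density_ge:
  assumes "integrable P (\<lambda>x. x\<^sup>2)"
  shows "(\<integral>x. ln (std_normal_density (y - r * x)) \<partial>P) \<le> ln (mom 0 r y)"
proof -
  let ?W = "\<lambda>x. ln (std_normal_density (y - r * x))"
  define m where "m = (\<integral>x. ?W x \<partial>P)"
  have "integrable P (\<lambda>x. - ln (sqrt (2 * pi)) - (y\<^sup>2 - 2 * y * r * x + r\<^sup>2 * x\<^sup>2) / 2)"
    using assms integrable_input by simp
  also have "(\<lambda>x. - ln (sqrt (2 * pi)) - (y\<^sup>2 - 2 * y * r * x + r\<^sup>2 * x\<^sup>2) / 2) = ?W"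
    by (simp add: ln_std_normal_density power2_eq_square algebra_simps fun_eq_iff)
  finally have int: "integrable P ?W" .
  \<comment> \<open>The graph of \<open>exp\<close> lies above its tangent line at the mean
    \<open>m\<close>.\<close>
  have "exp m * (1 + ?W x - m) \<le> std_normal_density (y - r * x)" for x
  proof -
    have "1 + ?W x - m \<le> exp (?W x - m)"
      using exp_ge_add_one_self[of "?W x - m"] by (simp only: add_diff_eq)
    then have "exp m * (1 + ?W x - m) \<le> exp m * exp (?W x - m)"
      by (intro mult_left_mono) auto
    also have "\<dots> = exp (?W x)"
      by (simp flip: exp_add)
    finally show ?thesis
      by (simp add: normal_density_pos)
  qed
  then have "(\<integral>x. exp m * (1 + ?W x - m) \<partial>P) \<le> (\<integral>x. std_normal_density (y - r * x) \<partial>P)"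
    using int integrable_mom[of 0 y r] by (intro integral_mono) auto
  also have "(\<integral>x. exp m * (1 + ?W x - m) \<partial>P) = exp m"
    using int prob_space by (simp add: m_def)
  finally have "exp m \<le> mom 0 r y"
    by (simp add: mom_def)
  then show ?thesis
    unfolding m_def[symmetric] by (simp add: ln_ge_iff)
qed

text \<open>Averaging the log density of \<open>z + t * (x - x')\<close> over the replica
  \<open>x'\<close> bounds \<open>log_output\<close> from below. What is left is a cross term
  \<open>t * ((x - \<mu>) * z)\<close>, with expectation 0 because the noise is centred and
  independent of the input, and a quadratic with expectation \<open>t\<^sup>2\<close> times the
  variance.\<close>

lemma info_le:
  assumes sq: "integrable P (\<lambda>x. x\<^sup>2)"
  shows "info t \<le> t\<^sup>2 * ((\<integral>x. x\<^sup>2 \<partial>P) - (\<integral>x. x \<partial>P)\<^sup>2)"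
proof -
  define \<mu> s where "\<mu> = (\<integral>x. x \<partial>P)" and "s = (\<integral>x. x\<^sup>2 \<partial>P)"
  let ?c = "ln (sqrt (2 * pi))"
  have intzx: "integrable R (\<lambda>w. (fst w - \<mu>) * snd w)"
  proof (rule Bochner_Integration.integrable_bound)
    show "integrable R (\<lambda>w. (fst w)\<^sup>2 - 2 * \<mu> * fst w + \<mu>\<^sup>2 + snd w ^ 2)"
      using integrable_R_fst(1)[OF sq] integrable_R_fst(1)[OF integrable_input]
        integrable_R_noise_power[of 2] by simp
    have "\<bar>(x - \<mu>) * z\<bar> \<le> x\<^sup>2 - 2 * \<mu> * x + \<mu>\<^sup>2 + z\<^sup>2" for x z
    proof -
      have "2 * \<bar>(x - \<mu>) * z\<bar> \<le> (x - \<mu>)\<^sup>2 + z\<^sup>2"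
        using sum_squares_bound[of "\<bar>x - \<mu>\<bar>" "\<bar>z\<bar>"] by (simp add: abs_mult)
      moreover have "(x - \<mu>)\<^sup>2 = x\<^sup>2 - 2 * \<mu> * x + \<mu>\<^sup>2"
        by (simp add: power2_diff)
      ultimately show ?thesis
        by linarith
    qed
    then show "AE w in R. norm ((fst w - \<mu>) * snd w) \<le> norm ((fst w)\<^sup>2 - 2 * \<mu> * fst w + \<mu>\<^sup>2 + snd w ^ 2)"
      by (intro AE_I2) (metis abs_ge_self order_trans real_norm_def)
  qed measurable
  have zx: "(\<integral>w. (fst w - \<mu>) * snd w \<partial>R) = 0"
    using PN.integral_fst'[OF intzx] by (simp add: integral_noise)
  have "info t \<le> (\<integral>w. t * ((fst w - \<mu>) * snd w) + t\<^sup>2 / 2 * ((fst w)\<^sup>2 - 2 * \<mu> * fst w + s) \<partial>R)"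
    unfolding info_def
  proof (rule integral_mono[OF integrable_info])
    show "integrable R (\<lambda>w. t * ((fst w - \<mu>) * snd w) + t\<^sup>2 / 2 * ((fst w)\<^sup>2 - 2 * \<mu> * fst w + s))"
      using intzx integrable_R_fst(1)[OF sq] integrable_R_fst(1)[OF integrable_input] by simp
    fix w :: "real \<times> real"
    define x z where "x = fst w" and "z = snd w"
    have "(\<integral>x'. ln (std_normal_density (t * x + z - t * x')) \<partial>P)
      = (\<integral>x'. (- ?c - z\<^sup>2 / 2 - t * x * z - t\<^sup>2 / 2 * x\<^sup>2) + (t * z + t\<^sup>2 * x) * x' - t\<^sup>2 / 2 * x'\<^sup>2 \<partial>P)"
      by (rule Bochner_Integration.integral_cong[OF refl])
         (simp add: ln_std_normal_density power2_eq_square field_simps)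
    also have "\<dots> = - ?c - z\<^sup>2 / 2 - (t * ((x - \<mu>) * z) + t\<^sup>2 / 2 * (x\<^sup>2 - 2 * \<mu> * x + s))"
      using sq integrable_input prob_space
      by (simp add: \<mu>_def[symmetric] s_def[symmetric]) (simp add: power2_eq_square field_simps)
    finally have "- ?c - z\<^sup>2 / 2 - (t * ((x - \<mu>) * z) + t\<^sup>2 / 2 * (x\<^sup>2 - 2 * \<mu> * x + s)) \<le> log_output t w"
      using ln_output_density_ge[OF sq, where y="t * x + z" and r=t]
      by (simp add: log_output_def x_def z_def)
    then show "ln (std_normal_density (snd w)) - log_output t w
        \<le> t * ((fst w - \<mu>) * snd w) + t\<^sup>2 / 2 * ((fst w)\<^sup>2 - 2 * \<mu> * fst w + s)"
      unfolding ln_std_normal_density x_def[symmetric] z_def[symmetric] by linarith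
  qed
  also have "\<dots> = t\<^sup>2 / 2 * (s - 2 * \<mu> * \<mu> + s)"
    using intzx zx integrable_R_fst[OF sq] integrable_R_fst[OF integrable_input] PN.prob_space
    by (simp add: \<mu>_def[symmetric] s_def[symmetric])
  also have "\<dots> = t\<^sup>2 * (s - \<mu>\<^sup>2)"
    by (simp add: power2_eq_square field_simps)
  finally show ?thesis
    unfolding \<mu>_def s_def .
qed

text \<open>Squeezed between 0 and \<open>t\<^sup>2 * K\<close>, the function vanishes at 0 and its
  difference quotients are at most \<open>\<bar>h\<bar> * K\<close>. Nonnegativity is supplied
  later, by that of mutual information.\<close>

lemma has_real_derivative_info_0:
  assumes "integrable P (\<lambda>x. x\<^sup>2)" and nonneg: "\<And>t. 0 \<le> info t"
  shows "(info has_real_derivative 0) (at 0)"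
proof -
  define K where "K = (\<integral>x. x\<^sup>2 \<partial>P) - (\<integral>x. x \<partial>P)\<^sup>2"
  have le: "info t \<le> t\<^sup>2 * K" for t
    using info_le[OF assms(1)] by (simp add: K_def)
  have 0: "info 0 = 0"
    using le[of 0] nonneg[of 0] by simp
  have "((\<lambda>h. info h / h) \<longlongrightarrow> 0) (at 0)"
  proof (rule Lim_null_comparison)
    show "\<forall>\<^sub>F h in at 0. norm (info h / h) \<le> \<bar>h\<bar> * K"
    proof (rule eventually_at_filter[THEN iffD2], rule always_eventually, intro allI impI)
      fix h :: real assume "h \<noteq> 0"
      then show "norm (info h / h) \<le> \<bar>h\<bar> * K"
        using le[of h] nonneg[of h] by (simp add: abs_div divide_le_eq power2_eq_square ac_simps flip: abs_mult)
    qed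
    show "((\<lambda>h::real. \<bar>h\<bar> * K) \<longlongrightarrow> 0) (at 0)"
      by (auto intro!: tendsto_eq_intros)
  qed
  then show ?thesis
    by (simp add: has_field_derivative_iff 0)
qed

end

section \<open>From laws to random variables on an arbitrary probability space\<close>

locale gaussian_pair = prob_space M for M :: "'a measure" +
  fixes X N :: "'a \<Rightarrow> real"
  assumes noise_density: "distributed M lborel N (\<lambda>x. ennreal (std_normal_density x))"
    and indep: "indep_var borel X borel N"
    and integrable_X: "integrable M X"
begin

lemma measurable_X [measurable]: "X \<in> borel_measurable M"
  and measurable_N [measurable]: "N \<in> borel_measurable M"
  using indep by (auto dest: indep_var_rv1 indep_var_rv2)

sublocale channel: gaussian_channel "distr M borel X"
proof -
  interpret distr: prob_space "distr M borel X"
    by (rule prob_space_distr) measurable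
  show "gaussian_channel (distr M borel X)"
    by unfold_locales (auto simp: integrable_distr_eq integrable_X)
qed

abbreviation Y :: "real \<Rightarrow> 'a \<Rightarrow> real" where
  "Y t \<equiv> gaussian_output t X N"

lemma measurable_Y [measurable]: "Y t \<in> borel_measurable M"
  unfolding gaussian_output_def by measurable

lemma distr_joint: "distr M (borel \<Otimes>\<^sub>M borel) (\<lambda>\<omega>. (X \<omega>, N \<omega>)) = channel.R"
proof -
  have "distr M borel N = std_normal"
    using distributed_distr_eq_density[OF noise_density] by (simp cong: distr_cong)
  then show ?thesis
    using indep by (simp add: indep_var_distribution_eq)
qed

lemma joint:
  fixes F :: "real \<times> real \<Rightarrow> real"
  assumes [measurable]: "F \<in> borel_measurable (borel \<Otimes>\<^sub>M borel)"
  shows "integrable channel.R F \<longleftrightarrow> integrable M (\<lambda>\<omega>. F (X \<omega>, N \<omega>))"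
    and "(\<integral>w. F w \<partial>channel.R) = (\<integral>\<omega>. F (X \<omega>, N \<omega>) \<partial>M)"
  unfolding distr_joint[symmetric] by (auto simp: integrable_distr_eq integral_distr)

text \<open>The input may lack a Lebesgue density. With its own law as reference measure it has
  density 1, so the density formula for mutual information applies.\<close>

lemma distributed_input: "distributed M (distr M borel X) X (\<lambda>x. ennreal 1)"
proof -
  have "distr M (distr M borel X) X = distr M borel X"
    by (rule distr_cong) auto
  then show ?thesis
    by (auto simp: distributed_def density_1)
qed

lemma distributed_input_output:
  "distributed M (distr M borel X \<Otimes>\<^sub>M lborel) (\<lambda>\<omega>. (X \<omega>, Y t \<omega>))
    (\<lambda>w. ennreal (std_normal_density (snd w - t * fst w)))"
proof -
  have "distr M (distr M borel X \<Otimes>\<^sub>M lborel) (\<lambda>\<omega>. (X \<omega>, Y t \<omega>))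
      = distr (distr M (borel \<Otimes>\<^sub>M borel) (\<lambda>\<omega>. (X \<omega>, N \<omega>))) (distr M borel X \<Otimes>\<^sub>M lborel)
          (\<lambda>w. (fst w, t * fst w + snd w))"
    by (subst distr_distr) (auto simp: comp_def gaussian_output_def)
  also have "\<dots> = density (distr M borel X \<Otimes>\<^sub>M lborel) (\<lambda>w. ennreal (std_normal_density (snd w - t * fst w)))"
    unfolding distr_joint by (rule channel.distr_channel)
  finally show ?thesis
    by (auto simp: distributed_def)
qed

lemma distributed_output: "distributed M lborel (Y t) (\<lambda>y. ennreal (channel.mom 0 t y))"
proof -
  have "distr M lborel (Y t) = density lborel (\<lambda>y. ennreal (channel.mom 0 t y))"
  proof (rule measure_eqI)
    fix A assume "A \<in> sets (distr M lborel (Y t))"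
    then have [measurable]: "A \<in> sets borel"
      by simp
    have "emeasure (distr M lborel (Y t)) A = (\<integral>\<^sup>+\<omega>. indicator A (t * X \<omega> + N \<omega>) \<partial>M)"
      by (subst nn_integral_indicator[symmetric], simp, subst nn_integral_distr)
         (auto simp: gaussian_output_def)
    also have "\<dots> = (\<integral>\<^sup>+w. indicator A (t * fst w + snd w) * ennreal (snd w ^ 0) \<partial>channel.R)"
      unfolding distr_joint[symmetric] by (subst nn_integral_distr) auto
    also have "\<dots> = (\<integral>\<^sup>+y. indicator A y * ennreal (channel.mom 0 t y) \<partial>lborel)"
      by (rule channel.nn_integral_output) auto
    also have "\<dots> = emeasure (density lborel (\<lambda>y. ennreal (channel.mom 0 t y))) A"
      by (subst emeasure_density) (auto simp: mult.commute)
    finally show "emeasure (distr M lborel (Y t)) A = \<dots>" .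
  qed simp
  then show ?thesis
    by (auto simp: distributed_def)
qed

text \<open>With the law of \<open>X\<close> and \<open>lborel\<close> as reference measures, the
  log ratio is that of \<open>std_normal_density (y - t * x)\<close> to \<open>mom 0 t y\<close>;
  changing variables back to the noise yields \<open>info\<close>. Nonnegativity follows from the
  integrability of this integrand.\<close>

lemma mutual_information_eq_info:
  "mutual_information_nats M X (Y t) = channel.info t" "0 \<le> channel.info t"
proof -
  interpret information_space M "exp 1"
    by unfold_locales simp
  let ?P = "distr M borel X"
  let ?f = "\<lambda>w. std_normal_density (snd w - t * fst w)
    * log (exp 1) (std_normal_density (snd w - t * fst w) / (1 * channel.mom 0 t (snd w)))"
  let ?G = "\<lambda>x y. ln (std_normal_density (y - t * x)) - ln (channel.mom 0 t y)"
  have [measurable]: "case_prod ?G \<in> borel_measurable (borel \<Otimes>\<^sub>M borel)"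
    by measurable
  have f: "?f = (\<lambda>w. std_normal_density (snd w - t * fst w) * ?G (fst w) (snd w))"
    by (simp add: log_def ln_divide_pos normal_density_pos fun_eq_iff)
  have G: "(\<lambda>w. ?G (fst w) (t * fst w + snd w)) = (\<lambda>w. ln (std_normal_density (snd w)) - channel.log_output t w)"
    by (simp add: channel.log_output_def)
  have intf: "integrable (?P \<Otimes>\<^sub>M lborel) ?f"
    unfolding f using channel.integral_channel(1)[of ?G t] channel.integrable_info[of t]
    by (simp add: channel.log_output_def)
  have S: "sigma_finite_measure ?P" and T: "sigma_finite_measure (lborel :: real measure)"
    by unfold_locales
  note MI = mutual_information_distr[OF S T distributed_input _ distributed_output _ distributed_input_output]
    mutual_information_nonneg[OF S T distributed_input _ distributed_output _ distributed_input_output]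
  \<comment> \<open>The reference measures enter the definition only through their sigma-algebras,
    which are Borel in both cases.\<close>
  have eq: "mutual_information (exp 1) ?P lborel X (Y t) = mutual_information_nats M X (Y t)"
  proof -
    have "distr M ?P X = distr M borel X" "distr M lborel (Y t) = distr M borel (Y t)"
      "distr M (?P \<Otimes>\<^sub>M lborel) (\<lambda>\<omega>. (X \<omega>, Y t \<omega>)) = distr M (borel \<Otimes>\<^sub>M borel) (\<lambda>\<omega>. (X \<omega>, Y t \<omega>))"
      by (auto intro!: distr_cong sets_pair_measure_cong)
    then show ?thesis
      by (simp add: mutual_information_def mutual_information_nats_def)
  qed
  have "mutual_information (exp 1) ?P lborel X (Y t) = integral\<^sup>L (?P \<Otimes>\<^sub>M lborel) ?f"
    by (rule MI(1)) (auto simp: less_imp_le)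
  also have "\<dots> = channel.info t"
    unfolding f channel.info_def G[symmetric] by (rule channel.integral_channel(2)[symmetric]) measurable
  finally show info: "mutual_information_nats M X (Y t) = channel.info t"
    by (simp add: eq)
  have "0 \<le> mutual_information (exp 1) ?P lborel X (Y t)"
    by (rule MI(2)) (use intf in \<open>auto simp: less_imp_le\<close>)
  then show "0 \<le> channel.info t"
    by (simp add: eq info)
qed

lemma subalgebra_output: "finite_measure_subalgebra M (vimage_algebra (space M) (Y t) borel)"
  by unfold_locales (auto simp: subalgebra_def sets_vimage_algebra2 intro!: measurable_sets)

text \<open>Every event of the sigma-algebra generated by the output is a preimage of a Borel set,
  so indicators of such sets suffice as test functions.\<close>

lemma cond_exp_given_output_eqI:
  assumes [measurable]: "g \<in> borel_measurable borel"
    and int: "integrable M (\<lambda>\<omega>. g (Y t \<omega>))"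
    and eq: "\<And>B. B \<in> sets borel \<Longrightarrow>
      (\<integral>\<omega>. indicator B (Y t \<omega>) * X \<omega> \<partial>M) = (\<integral>\<omega>. indicator B (Y t \<omega>) * g (Y t \<omega>) \<partial>M)"
  shows "AE \<omega> in M. cond_exp_given M X (Y t) \<omega> = g (Y t \<omega>)"
proof -
  let ?F = "vimage_algebra (space M) (Y t) borel"
  interpret finite_measure_subalgebra M ?F
    by (rule subalgebra_output)
  show ?thesis
    unfolding cond_exp_given_def
  proof (rule real_cond_exp_charact)
    fix A assume "A \<in> sets ?F"
    then obtain B where B: "B \<in> sets borel" "A = Y t -` B \<inter> space M"
      by (auto simp: sets_vimage_algebra2)
    have "(\<integral>\<omega>\<in>A. f \<omega> \<partial>M) = (\<integral>\<omega>. indicator B (Y t \<omega>) * f \<omega> \<partial>M)" for f :: "'a \<Rightarrow> real"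
      unfolding set_lebesgue_integral_def B(2)
      by (rule Bochner_Integration.integral_cong) (auto simp: indicator_def)
    then show "(\<integral>\<omega>\<in>A. X \<omega> \<partial>M) = (\<integral>\<omega>\<in>A. g (Y t \<omega>) \<partial>M)"
      using eq[OF B(1)] by simp
  next
    show "(\<lambda>\<omega>. g (Y t \<omega>)) \<in> borel_measurable ?F"
      by (rule measurable_compose[OF measurable_vimage_algebra1]) auto
  qed (use int integrable_X in auto)
qed

text \<open>Condition \<open>X = (Y - N) / t\<close> on the output, with
  \<open>noise_estimate\<close> as the conditional expectation of the noise.\<close>

lemma cond_exp_given_output:
  assumes "t \<noteq> 0"
  shows "AE \<omega> in M. cond_exp_given M X (Y t) \<omega> = (Y t \<omega> - channel.noise_estimate t (Y t \<omega>)) / t"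
proof (rule cond_exp_given_output_eqI)
  note orth = channel.noise_estimate_orthogonal[where r=t]
  have "integrable channel.R (\<lambda>w. channel.noise_estimate t (t * fst w + snd w))"
    using orth(2)[of "\<lambda>_. 1"] channel.PN.integrable_const by simp
  then have ne: "integrable M (\<lambda>\<omega>. channel.noise_estimate t (Y t \<omega>))"
    by (subst (asm) joint) (auto simp: gaussian_output_def)
  have N: "integrable M N"
    using channel.integrable_R_noise_power[of 1] by (subst (asm) joint) auto
  have Y: "integrable M (Y t)"
    unfolding gaussian_output_def using N integrable_X by simp
  show intg: "integrable M (\<lambda>\<omega>. (Y t \<omega> - channel.noise_estimate t (Y t \<omega>)) / t)"
    using Y ne by simp
  fix B :: "real set" assume [measurable]: "B \<in> sets borel"
  \<comment> \<open>Indicators are bounded, hence admissible as \<open>h\<close> in the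
    orthogonality relation.\<close>
  have "integrable channel.R (\<lambda>w. (indicator B (t * fst w + snd w) :: real)\<^sup>2)"
    by (rule channel.PN.integrable_const_bound[where B=1]) (auto simp: indicator_def)
  from orth(3)[OF _ this]
  have "(\<integral>\<omega>. indicator B (Y t \<omega>) * N \<omega> \<partial>M)
      = (\<integral>\<omega>. indicator B (Y t \<omega>) * channel.noise_estimate t (Y t \<omega>) \<partial>M)"
    by (simp add: joint gaussian_output_def)
  moreover have ind: "integrable M (\<lambda>\<omega>. indicator B (Y t \<omega>) * f \<omega>)" if "integrable M f" for f :: "'a \<Rightarrow> real"
    by (rule Bochner_Integration.integrable_bound[OF that]) (use that in \<open>auto simp: indicator_def\<close>)
  moreover have "indicator B (Y t \<omega>) * X \<omega> = (indicator B (Y t \<omega>) * Y t \<omega> - indicator B (Y t \<omega>) * N \<omega>) / t" for \<omega>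
    using assms by (simp add: gaussian_output_def field_simps)
  ultimately show "(\<integral>\<omega>. indicator B (Y t \<omega>) * X \<omega> \<partial>M)
    = (\<integral>\<omega>. indicator B (Y t \<omega>) * ((Y t \<omega> - channel.noise_estimate t (Y t \<omega>)) / t) \<partial>M)"
    using ind[OF Y] ind[OF N] ind[OF ne] by (simp add: right_diff_distrib)
qed measurable

text \<open>The estimation error of the input is, up to sign, that of the noise divided by
  \<open>t\<close>, so the weight \<open>t\<close> leaves \<open>1 / t\<close> in front of
  \<open>noise_mmse\<close>.\<close>

lemma mmse_output:
  assumes "t \<noteq> 0"
  shows "(\<integral>\<omega>. t * (X \<omega> - cond_exp_given M X (Y t) \<omega>)\<^sup>2 \<partial>M) = (1 - channel.J t) / t"
proof -
  have "(\<integral>\<omega>. t * (X \<omega> - cond_exp_given M X (Y t) \<omega>)\<^sup>2 \<partial>M)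
      = (\<integral>\<omega>. (channel.noise_estimate t (Y t \<omega>) - N \<omega>)\<^sup>2 / t \<partial>M)"
  proof (rule integral_cong_AE)
    show "(\<lambda>\<omega>. t * (X \<omega> - cond_exp_given M X (Y t) \<omega>)\<^sup>2) \<in> borel_measurable M"
      unfolding cond_exp_given_def by measurable
    show "AE \<omega> in M. t * (X \<omega> - cond_exp_given M X (Y t) \<omega>)\<^sup>2 = (channel.noise_estimate t (Y t \<omega>) - N \<omega>)\<^sup>2 / t"
      using cond_exp_given_output[OF assms]
    proof eventually_elim
      case (elim \<omega>)
      have "X \<omega> - cond_exp_given M X (Y t) \<omega> = (channel.noise_estimate t (Y t \<omega>) - N \<omega>) / t"
        using assms unfolding elim by (simp add: gaussian_output_def field_simps)
      then show ?case
        using assms by (simp add: power2_eq_square)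
    qed
  qed measurable
  also have "\<dots> = (1 - channel.J t) / t"
    using channel.noise_mmse[of t] by (subst (asm) joint) (auto simp: gaussian_output_def)
  finally show ?thesis .
qed

text \<open>At scale 0 the output is the noise, which is independent of \<open>X\<close>. The
  conditional expectation is therefore the mean \<open>c\<close>, and the hypothesis says that
  \<open>X - c\<close> is square integrable.\<close>

lemma integrable_input_square:
  assumes "integrable M (\<lambda>\<omega>. (X \<omega> - cond_exp_given M X (Y 0) \<omega>)\<^sup>2)"
  shows "integrable (distr M borel X) (\<lambda>x. x\<^sup>2)"
proof -
  define c where "c = expectation X"
  have "AE \<omega> in M. cond_exp_given M X (Y 0) \<omega> = c"
  proof (rule cond_exp_given_output_eqI[where g="\<lambda>_. c"])
    fix B :: "real set" assume [measurable]: "B \<in> sets borel"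
    have "indep_var borel (id \<circ> X) borel ((indicator B :: real \<Rightarrow> real) \<circ> N)"
      by (rule indep_var_compose[OF indep]) auto
    then have "(\<integral>\<omega>. X \<omega> * indicator B (N \<omega>) \<partial>M) = c * (\<integral>\<omega>. indicator B (N \<omega>) \<partial>M)"
      unfolding c_def
      by (intro indep_var_lebesgue_integral) (auto simp: comp_def integrable_X intro!: integrable_const_bound[where B=1])
    then show "(\<integral>\<omega>. indicator B (Y 0 \<omega>) * X \<omega> \<partial>M) = (\<integral>\<omega>. indicator B (Y 0 \<omega>) * c \<partial>M)"
      by (simp add: gaussian_output_def mult.commute)
  qed auto
  then have "AE \<omega> in M. (X \<omega> - cond_exp_given M X (Y 0) \<omega>)\<^sup>2 = (X \<omega> - c)\<^sup>2"
    by eventually_elim simp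
  with assms have "integrable M (\<lambda>\<omega>. (X \<omega> - c)\<^sup>2)"
    by (subst (asm) integrable_cong_AE) (auto simp: cond_exp_given_def)
  then have "integrable M (\<lambda>\<omega>. (X \<omega> - c)\<^sup>2 + 2 * c * X \<omega> - c\<^sup>2)"
    using integrable_X by simp
  also have "(\<lambda>\<omega>. (X \<omega> - c)\<^sup>2 + 2 * c * X \<omega> - c\<^sup>2) = (\<lambda>\<omega>. (X \<omega>)\<^sup>2)"
    by (simp add: power2_eq_square algebra_simps fun_eq_iff)
  finally show ?thesis
    by (simp add: integrable_distr_eq)
qed

end

theorem corollary3:
  fixes M :: "'a measure" and X N :: "'a \<Rightarrow> real" and \<phi> :: real
  assumes "prob_space M"
    and "distributed M lborel N (\<lambda>x. ennreal (std_normal_density x))"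
    and "prob_space.indep_var M borel X borel N"
    and "integrable M X"
    and "integrable M (\<lambda>\<omega>. (X \<omega> - cond_exp_given M X (gaussian_output \<phi> X N) \<omega>)\<^sup>2)"
  shows "((\<lambda>t. mutual_information_nats M X (gaussian_output t X N)) has_real_derivative
      (\<integral>\<omega>. bregman_divergence (\<lambda>x. \<phi> * x\<^sup>2) (X \<omega>)
               (cond_exp_given M X (gaussian_output \<phi> X N) \<omega>) \<partial>M)) (at \<phi>)"
proof -
  interpret gaussian_pair M X N
    using assms(1-4) by (simp add: gaussian_pair_def gaussian_pair_axioms_def)
  have "(channel.info has_real_derivative
      (\<integral>\<omega>. \<phi> * (X \<omega> - cond_exp_given M X (Y \<phi>) \<omega>)\<^sup>2 \<partial>M)) (at \<phi>)"
  \<comment> \<open>At 0 the factor \<open>\<phi>\<close> annihilates the right-hand side, in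
    agreement with derivative 0; elsewhere both sides are
    \<open>(1 - J \<phi>) / \<phi>\<close>.\<close>
  proof (cases "\<phi> = 0")
    case True
    then show ?thesis
      using channel.has_real_derivative_info_0[OF integrable_input_square mutual_information_eq_info(2)] assms(5)
      by simp
  next
    case False
    then show ?thesis
      unfolding mmse_output[OF False] by (rule channel.has_real_derivative_info)
  qed
  then show ?thesis
    by (simp add: mutual_information_eq_info(1) bregman_divergence_square)
qed

end
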